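(* Let $T$ be a subresiduated Nelson algebra and $x,y,z,w\in T$. Let $\theta(x,y)$ denote the congruence of $T$ generated by the pair $(x,y)$, i.e. the least congruence of $T$ containing $(x,y)$. Then $(z,w)\in\theta(x,y)$ if and only if $s(x,y)\to s(z,w)=1$.
   Context: A Kleene algebra is a bounded distributive lattice $\langle T,\wedge,\vee,0,1\rangle$ with a unary operation $\sim$ satisfying $\sim\sim x=x$, $\sim(x\wedge y)=\sim x\vee\sim y$, $(x\wedge\sim x)\wedge(y\vee\sim y)=x\wedge\sim x$. A subresiduated Nelson algebra is an algebra $\langle T,\wedge,\vee,\to,\sim,0,1\rangle$ of type $(2,2,2,1,0,0)$ such that $\langle T,\wedge,\vee,\sim,0,1\rangle$ is a Kleene algebra and for all $x,y,z\in T$: (1) $(x\vee y)\to z=(x\to z)\wedge(y\to z)$; (2) $z\to(x\wedge y)=(z\to x)\wedge(z\to y)$; (3) $((x\to y)\wedge(y\to z))\to(x\to z)=1$; (4) $x\to x=1$; (5) $x\wedge(x\to y)\le x\wedge(\sim x\vee y)$; (6) $x\to y\le z\to(x\to y)$; (7) $\sim(x\to y)\to(x\wedge\sim y)=1$; (8) $(x\wedge\sim y)\to\sim(x\to y)=1$. For $x,y\in T$, $s(x,y)=(x\to y)\wedge(y\to x)\wedge(\sim x\to\sim y)\wedge(\sim y\to\sim x)$. *)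

theory Defs
  imports Main
begin

unbundle lattice_syntax

class kleene_algebra = distrib_lattice + bounded_lattice +
  fixes neg :: "'a \<Rightarrow> 'a"  (\<open>(\<open>open_block notation=\<open>prefix neg\<close>\<close>\<sim> _)\<close> [81] 80)
  assumes neg_neg: "\<sim> (\<sim> x) = x"
    and neg_inf: "\<sim> (x \<sqinter> y) = \<sim> x \<squnion> \<sim> y"
    and kleene: "(x \<sqinter> \<sim> x) \<sqinter> (y \<squnion> \<sim> y) = x \<sqinter> \<sim> x"

class subresiduated_nelson_algebra = kleene_algebra +
  fixes imp :: "'a \<Rightarrow> 'a \<Rightarrow> 'a"  (infixr \<open>\<rightarrow>\<close> 60)
  assumes sup_imp: "((x \<squnion> y) \<rightarrow> z) = (x \<rightarrow> z) \<sqinter> (y \<rightarrow> z)"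
    and imp_inf: "(z \<rightarrow> (x \<sqinter> y)) = (z \<rightarrow> x) \<sqinter> (z \<rightarrow> y)"
    and imp_trans: "(((x \<rightarrow> y) \<sqinter> (y \<rightarrow> z)) \<rightarrow> (x \<rightarrow> z)) = \<top>"
    and imp_refl: "(x \<rightarrow> x) = \<top>"
    and inf_imp_le: "x \<sqinter> (x \<rightarrow> y) \<le> x \<sqinter> (\<sim> x \<squnion> y)"
    and imp_le_imp: "(x \<rightarrow> y) \<le> (z \<rightarrow> (x \<rightarrow> y))"
    and neg_imp_imp: "(\<sim> (x \<rightarrow> y) \<rightarrow> (x \<sqinter> \<sim> y)) = \<top>"
    and imp_neg_imp: "((x \<sqinter> \<sim> y) \<rightarrow> \<sim> (x \<rightarrow> y)) = \<top>"

definition s :: "'a::subresiduated_nelson_algebra \<Rightarrow> 'a \<Rightarrow> 'a" where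
  "s x y = (x \<rightarrow> y) \<sqinter> (y \<rightarrow> x) \<sqinter> (\<sim> x \<rightarrow> \<sim> y) \<sqinter> (\<sim> y \<rightarrow> \<sim> x)"

definition congruence :: "'a::subresiduated_nelson_algebra rel \<Rightarrow> bool" where
  "congruence \<theta> \<longleftrightarrow> equiv UNIV \<theta> \<and>
     (\<forall>a b c d. (a, b) \<in> \<theta> \<longrightarrow> (c, d) \<in> \<theta> \<longrightarrow>
        (a \<sqinter> c, b \<sqinter> d) \<in> \<theta> \<and> (a \<squnion> c, b \<squnion> d) \<in> \<theta> \<and> (a \<rightarrow> c, b \<rightarrow> d) \<in> \<theta>) \<and>
     (\<forall>a b. (a, b) \<in> \<theta> \<longrightarrow> (\<sim> a, \<sim> b) \<in> \<theta>)"

definition cong_gen :: "'a::subresiduated_nelson_algebra \<Rightarrow> 'a \<Rightarrow> 'a rel" where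
  "cong_gen x y = \<Inter>{\<theta>. congruence \<theta> \<and> (x, y) \<in> \<theta>}"

lemma congruence_UNIV: "congruence UNIV"
  by (auto simp: congruence_def equiv_def refl_on_def sym_def trans_def)

lemma congruence_cong_gen: "congruence (cong_gen x y)"
  unfolding congruence_def
proof (intro conjI)
  show "equiv UNIV (cong_gen x y)"
    by (intro equivI refl_onI symI transI)
       (auto simp: cong_gen_def congruence_def equiv_def elim: refl_onD symE transE)
qed (simp_all add: cong_gen_def congruence_def)

lemma pair_in_cong_gen: "(x, y) \<in> cong_gen x y"
  by (simp add: cong_gen_def)

lemma cong_gen_least: "congruence \<theta> \<Longrightarrow> (x, y) \<in> \<theta> \<Longrightarrow> cong_gen x y \<subseteq> \<theta>"
  by (auto simp: cong_gen_def)

end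

theory Submission
  imports Defs
begin

text \<open>
  Write \<open>a \<preceq> b\<close> for \<open>(a \<rightarrow> b) = \<top>\<close>. This is a preorder that extends the lattice order but is not
  antisymmetric: in the three-element Nelson chain with middle element \<open>h\<close>, \<open>h \<preceq> \<bottom>\<close>. Up to
  \<open>\<preceq>\<close>, however, the operation \<open>\<rightarrow>\<close> behaves as in a subresiduated lattice: elements \<open>f\<close> with
  \<open>f \<le> \<top> \<rightarrow> f\<close>, here called open, satisfy the deduction rule that \<open>g \<sqinter> f \<preceq> h\<close> implies
  \<open>f \<preceq> g \<rightarrow> h\<close> (\<open>deduction_open\<close>). Every implication is open, and so is every meet of
  implications; in particular \<open>s x y\<close> is.

  For open \<open>f\<close>, read \<open>f \<preceq> a \<rightarrow> b\<close> as \<open>a\<close> lying below \<open>b\<close> under the hypothesis \<open>f\<close>. For this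
  relation, transitivity of implication and the deduction rule make \<open>\<sqinter>\<close> and \<open>\<squnion>\<close> monotone and
  \<open>\<rightarrow>\<close> monotone on the right and antitone on the left. Moreover, \<open>\<sim> (a \<rightarrow> b)\<close> is equivalent to
  \<open>a \<sqinter> \<sim> b\<close> for \<open>\<preceq>\<close>. Hence requiring the relation in both directions for a pair and for the
  negated pair, which is exactly \<open>f \<preceq> s a b\<close>, gives a congruence (\<open>congruence_cong_under\<close>).
  For \<open>f = s x y\<close> this congruence relates \<open>x\<close> to \<open>y\<close>, so it contains the one generated by that pair.

  Conversely, a congruence that contains \<open>(x, y)\<close> identifies \<open>s x y\<close> with \<open>s x x = \<top>\<close>. If moreover
  \<open>s x y \<preceq> s z w\<close>, then it identifies \<open>\<top> \<rightarrow> s z w\<close>, hence the larger element \<open>s z w\<close>, with \<open>\<top>\<close>.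
  What remains is that \<open>s z w\<close> measures equality: the Kleene inequality yields the bound
  \<open>inf_imp_imp_neg_le\<close>, which in the quotient reads \<open>z \<le> w\<close> and, by symmetry, \<open>w \<le> z\<close>.
\<close>

section \<open>The preorder given by implication\<close>

lemma neg_sup: "\<sim> (x \<squnion> y) = \<sim> x \<sqinter> \<sim> (y::'a::kleene_algebra)"
  by (metis neg_inf neg_neg)

lemma neg_antimono: "x \<le> y \<Longrightarrow> \<sim> y \<le> \<sim> (x::'a::kleene_algebra)"
  by (metis inf.absorb_iff1 neg_inf sup_ge2)

lemma neg_top: "\<sim> (\<top>::'a::kleene_algebra) = \<bottom>"
  by (metis bot_least bot_unique neg_antimono neg_neg top_greatest)

lemma imp_mono_right:
  fixes x y z :: "'a::subresiduated_nelson_algebra"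
  shows "y \<le> z \<Longrightarrow> x \<rightarrow> y \<le> x \<rightarrow> z"
  by (metis imp_inf inf.absorb_iff1)

lemma imp_antimono_left:
  fixes x y z :: "'a::subresiduated_nelson_algebra"
  shows "x \<le> y \<Longrightarrow> y \<rightarrow> z \<le> x \<rightarrow> z"
  by (metis sup_imp inf.cobounded1 sup.absorb_iff2)

lemma imp_eq_top_if_le:
  fixes x y :: "'a::subresiduated_nelson_algebra"
  shows "x \<le> y \<Longrightarrow> (x \<rightarrow> y) = \<top>"
  by (metis imp_mono_right imp_refl top_le)

lemma top_imp_le: "(\<top> \<rightarrow> x) \<le> (x::'a::subresiduated_nelson_algebra)"
  using inf_imp_le[of \<top> x] by (simp add: neg_top)

lemma imp_eq_top_trans:
  fixes x y z :: "'a::subresiduated_nelson_algebra"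
  assumes "(x \<rightarrow> y) = \<top>" and "(y \<rightarrow> z) = \<top>"
  shows "(x \<rightarrow> z) = \<top>"
  using imp_trans[of x y z] top_imp_le[of "x \<rightarrow> z"] assms by (simp add: top_le)

text \<open>
  The condition \<open>f \<le> \<top> \<rightarrow> f\<close> replaces the adjunction between meet and implication: it gives
  \<open>f \<le> g \<rightarrow> f\<close>, and the latter equals \<open>g \<rightarrow> (g \<sqinter> f)\<close>, which composes with \<open>(g \<sqinter> f) \<rightarrow> h\<close>.
\<close>

lemma deduction_open:
  fixes f g h :: "'a::subresiduated_nelson_algebra"
  assumes "f \<le> \<top> \<rightarrow> f" and "(g \<sqinter> f \<rightarrow> h) = \<top>"
  shows "(f \<rightarrow> (g \<rightarrow> h)) = \<top>"
proof -
  have "f \<le> g \<rightarrow> f"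
    using assms(1) imp_antimono_left[of g \<top> f] by (meson order_trans top_greatest)
  also have "\<dots> = (g \<rightarrow> g \<sqinter> f)"
    by (simp add: imp_inf imp_refl)
  finally have "(f \<rightarrow> (g \<rightarrow> g \<sqinter> f)) = \<top>"
    by (rule imp_eq_top_if_le)
  moreover have "((g \<rightarrow> g \<sqinter> f) \<rightarrow> (g \<rightarrow> h)) = \<top>"
    using imp_trans[of g "g \<sqinter> f" h] assms(2) by simp
  ultimately show ?thesis
    by (rule imp_eq_top_trans)
qed

lemma s_open: "s x y \<le> \<top> \<rightarrow> s x y"
  unfolding s_def imp_inf by (intro inf_mono imp_le_imp)

section \<open>The order under an open hypothesis\<close>

definition le_under :: "'a::subresiduated_nelson_algebra \<Rightarrow> 'a \<Rightarrow> 'a \<Rightarrow> bool" where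
  "le_under f a b \<longleftrightarrow> (f \<rightarrow> (a \<rightarrow> b)) = \<top>"

lemma le_under_if_imp_eq_top: "(a \<rightarrow> b) = \<top> \<Longrightarrow> le_under f a b"
  by (simp add: le_under_def imp_eq_top_if_le)

lemma le_under_trans:
  assumes "le_under f a b" and "le_under f b c"
  shows "le_under f a c"
proof -
  have "(f \<rightarrow> (a \<rightarrow> b) \<sqinter> (b \<rightarrow> c)) = \<top>"
    using assms by (simp add: le_under_def imp_inf)
  then show ?thesis
    unfolding le_under_def using imp_trans imp_eq_top_trans by blast
qed

lemma le_under_inf_greatest: "le_under f a b \<Longrightarrow> le_under f a c \<Longrightarrow> le_under f a (b \<sqinter> c)"
  by (simp add: le_under_def imp_inf)

lemma le_under_sup_least: "le_under f a c \<Longrightarrow> le_under f b c \<Longrightarrow> le_under f (a \<squnion> b) c"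
  by (simp add: le_under_def imp_inf sup_imp)

lemma le_under_inf_mono:
  assumes "le_under f a b" and "le_under f c d"
  shows "le_under f (a \<sqinter> c) (b \<sqinter> d)"
proof (rule le_under_inf_greatest)
  show "le_under f (a \<sqinter> c) b"
    using le_under_trans[OF _ assms(1)] by (simp add: le_under_if_imp_eq_top imp_eq_top_if_le)
  show "le_under f (a \<sqinter> c) d"
    using le_under_trans[OF _ assms(2)] by (simp add: le_under_if_imp_eq_top imp_eq_top_if_le)
qed

lemma le_under_sup_mono:
  assumes "le_under f a b" and "le_under f c d"
  shows "le_under f (a \<squnion> c) (b \<squnion> d)"
proof (rule le_under_sup_least)
  show "le_under f a (b \<squnion> d)"
    using le_under_trans[OF assms(1)] by (simp add: le_under_if_imp_eq_top imp_eq_top_if_le)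
  show "le_under f c (b \<squnion> d)"
    using le_under_trans[OF assms(2)] by (simp add: le_under_if_imp_eq_top imp_eq_top_if_le)
qed

text \<open>
  The hypothesis \<open>f\<close> together with \<open>a \<rightarrow> c\<close> yields the chain \<open>b \<rightarrow> a\<close>, \<open>a \<rightarrow> c\<close>, \<open>c \<rightarrow> d\<close>; openness of
  \<open>f\<close> is what allows \<open>a \<rightarrow> c\<close> to be discharged afterwards.
\<close>

lemma le_under_imp_mono:
  assumes "f \<le> \<top> \<rightarrow> f" and "le_under f b a" and "le_under f c d"
  shows "le_under f (a \<rightarrow> c) (b \<rightarrow> d)"
  unfolding le_under_def
proof (rule deduction_open[OF assms(1)])
  let ?e = "(a \<rightarrow> c) \<sqinter> f"
  have weaken: "le_under ?e u v" if "le_under f u v" for u v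
    using that imp_eq_top_if_le[of ?e f] imp_eq_top_trans
    unfolding le_under_def by (meson inf_le2)
  have "le_under ?e a c"
    by (simp add: le_under_def imp_eq_top_if_le)
  then have "le_under ?e b d"
    using weaken[OF assms(2)] weaken[OF assms(3)] by (blast intro: le_under_trans)
  then show "(?e \<rightarrow> (b \<rightarrow> d)) = \<top>"
    by (simp add: le_under_def)
qed

lemma le_under_neg_imp_mono:
  assumes "le_under f a b" and "le_under f (\<sim> c) (\<sim> d)"
  shows "le_under f (\<sim> (a \<rightarrow> c)) (\<sim> (b \<rightarrow> d))"
proof -
  have "le_under f (\<sim> (a \<rightarrow> c)) (a \<sqinter> \<sim> c)"
    by (rule le_under_if_imp_eq_top[OF neg_imp_imp])
  moreover have "le_under f (a \<sqinter> \<sim> c) (b \<sqinter> \<sim> d)"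
    by (rule le_under_inf_mono[OF assms])
  moreover have "le_under f (b \<sqinter> \<sim> d) (\<sim> (b \<rightarrow> d))"
    by (rule le_under_if_imp_eq_top[OF imp_neg_imp])
  ultimately show ?thesis
    by (blast intro: le_under_trans)
qed

section \<open>The congruence determined by an open element\<close>

definition cong_under :: "'a::subresiduated_nelson_algebra \<Rightarrow> 'a rel" where
  "cong_under f = {(a, b). (f \<rightarrow> s a b) = \<top>}"

lemma mem_cong_under_iff:
  "(a, b) \<in> cong_under f \<longleftrightarrow>
    le_under f a b \<and> le_under f b a \<and> le_under f (\<sim> a) (\<sim> b) \<and> le_under f (\<sim> b) (\<sim> a)"
  by (simp add: cong_under_def s_def le_under_def imp_inf conj_assoc)

lemma equiv_cong_under: "equiv UNIV (cong_under f)"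
proof (intro equivI refl_onI symI transI)
  show "cong_under f \<subseteq> UNIV \<times> UNIV"
    by simp
  show "(a, a) \<in> cong_under f" for a
    by (simp add: mem_cong_under_iff le_under_if_imp_eq_top imp_refl)
  show "(b, a) \<in> cong_under f" if "(a, b) \<in> cong_under f" for a b
    using that by (simp add: mem_cong_under_iff)
  show "(a, c) \<in> cong_under f" if "(a, b) \<in> cong_under f" "(b, c) \<in> cong_under f" for a b c
    using that unfolding mem_cong_under_iff by (blast intro: le_under_trans)
qed

lemma congruence_cong_under:
  assumes "f \<le> \<top> \<rightarrow> f"
  shows "congruence (cong_under f)"
  unfolding congruence_def
proof (intro conjI allI impI)
  show "equiv UNIV (cong_under f)"
    by (rule equiv_cong_under)
next
  fix a b c d
  assume "(a, b) \<in> cong_under f" and "(c, d) \<in> cong_under f"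
  note le = this[unfolded mem_cong_under_iff]
  show "(a \<sqinter> c, b \<sqinter> d) \<in> cong_under f"
    using le by (simp add: mem_cong_under_iff neg_inf le_under_inf_mono le_under_sup_mono)
  show "(a \<squnion> c, b \<squnion> d) \<in> cong_under f"
    using le by (simp add: mem_cong_under_iff neg_sup le_under_inf_mono le_under_sup_mono)
  show "(a \<rightarrow> c, b \<rightarrow> d) \<in> cong_under f"
    using le assms by (simp add: mem_cong_under_iff le_under_imp_mono le_under_neg_imp_mono)
next
  fix a b
  assume "(a, b) \<in> cong_under f"
  then show "(\<sim> a, \<sim> b) \<in> cong_under f"
    by (simp add: mem_cong_under_iff neg_neg)
qed

section \<open>Congruences identify exactly the pairs whose s is identified with the top\<close>

text \<open>
  A form of antisymmetry that survives passage to quotients: when both implications are identified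
  with \<open>\<top>\<close>, it says \<open>z \<le> w\<close>. Detaching \<open>z \<rightarrow> w\<close> only gives \<open>\<sim> z \<squnion> w\<close>. The excess \<open>z \<sqinter> \<sim> z\<close> lies
  below \<open>w \<squnion> \<sim> w\<close> by the Kleene inequality, and its part \<open>z \<sqinter> \<sim> w\<close> is controlled by the negation of
  what detaching \<open>\<sim> w \<rightarrow> \<sim> z\<close> gives.
\<close>

lemma inf_imp_imp_neg_le:
  fixes z w :: "'a::subresiduated_nelson_algebra"
  shows "z \<sqinter> (z \<rightarrow> w) \<sqinter> (\<sim> w \<rightarrow> \<sim> z) \<le> w \<squnion> \<sim> (\<sim> w \<rightarrow> \<sim> z)"
    (is "z \<sqinter> ?p \<sqinter> ?q \<le> ?r")
proof -
  have "\<sim> w \<sqinter> ?q \<le> w \<squnion> \<sim> z"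
    using inf_imp_le[of "\<sim> w" "\<sim> z"] by (simp add: neg_neg)
  from neg_antimono[OF this] have "z \<sqinter> \<sim> w \<le> ?r"
    by (simp add: neg_inf neg_sup neg_neg inf_commute)
  moreover have "z \<sqinter> \<sim> z \<le> w \<squnion> \<sim> w"
    using kleene[of z w] by (metis inf.absorb_iff1)
  then have "z \<sqinter> \<sim> z \<le> z \<sqinter> (w \<squnion> \<sim> w)"
    by simp
  then have "z \<sqinter> \<sim> z \<le> (z \<sqinter> w) \<squnion> (z \<sqinter> \<sim> w)"
    by (simp only: inf_sup_distrib1)
  moreover have "z \<sqinter> w \<le> ?r"
    by (simp add: le_infI2)
  ultimately have excess: "z \<sqinter> \<sim> z \<le> ?r"
    by (meson le_supI order_trans)
  have "z \<sqinter> ?p \<sqinter> ?q \<le> z \<sqinter> (\<sim> z \<squnion> w)"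
    using inf_imp_le[of z w] by (rule le_infI1)
  also have "\<dots> = (z \<sqinter> \<sim> z) \<squnion> (z \<sqinter> w)"
    by (rule inf_sup_distrib1)
  also have "\<dots> \<le> ?r"
    using excess \<open>z \<sqinter> w \<le> ?r\<close> by (rule le_supI)
  finally show ?thesis .
qed

context
  fixes \<theta> :: "'a::subresiduated_nelson_algebra rel"
  assumes cong: "congruence \<theta>"
begin

lemma cong_refl: "(a, a) \<in> \<theta>"
  using cong by (auto simp: congruence_def equiv_def refl_on_def)

lemma cong_sym: "(a, b) \<in> \<theta> \<Longrightarrow> (b, a) \<in> \<theta>"
  using cong by (auto simp: congruence_def equiv_def elim: symE)

lemma cong_trans: "(a, b) \<in> \<theta> \<Longrightarrow> (b, c) \<in> \<theta> \<Longrightarrow> (a, c) \<in> \<theta>"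
  using cong by (auto simp: congruence_def equiv_def elim: transE)

lemma cong_inf: "(a, b) \<in> \<theta> \<Longrightarrow> (c, d) \<in> \<theta> \<Longrightarrow> (a \<sqinter> c, b \<sqinter> d) \<in> \<theta>"
  and cong_sup: "(a, b) \<in> \<theta> \<Longrightarrow> (c, d) \<in> \<theta> \<Longrightarrow> (a \<squnion> c, b \<squnion> d) \<in> \<theta>"
  and cong_imp: "(a, b) \<in> \<theta> \<Longrightarrow> (c, d) \<in> \<theta> \<Longrightarrow> (a \<rightarrow> c, b \<rightarrow> d) \<in> \<theta>"
  and cong_neg: "(a, b) \<in> \<theta> \<Longrightarrow> (\<sim> a, \<sim> b) \<in> \<theta>"
  using cong by (simp_all add: congruence_def)

lemma cong_top_mono:
  assumes "(a, \<top>) \<in> \<theta>" and "a \<le> b"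
  shows "(b, \<top>) \<in> \<theta>"
  using cong_sup[OF assms(1) cong_refl[of b]] assms(2) by (simp add: sup.absorb2)

lemma cong_s_top:
  assumes "(x, y) \<in> \<theta>"
  shows "(s x y, \<top>) \<in> \<theta>"
proof -
  have "(s x y, s y y) \<in> \<theta>"
    unfolding s_def using assms by (intro cong_inf cong_imp cong_neg cong_refl)
  then show ?thesis
    by (simp add: s_def imp_refl)
qed

lemma cong_inf_if_imps_top:
  assumes p: "(z \<rightarrow> w, \<top>) \<in> \<theta>" and q: "(\<sim> w \<rightarrow> \<sim> z, \<top>) \<in> \<theta>"
  shows "(z, z \<sqinter> w) \<in> \<theta>"
proof -
  let ?l = "z \<sqinter> (z \<rightarrow> w) \<sqinter> (\<sim> w \<rightarrow> \<sim> z)" and ?r = "w \<squnion> \<sim> (\<sim> w \<rightarrow> \<sim> z)"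
  have l: "(?l, z) \<in> \<theta>"
    using cong_inf[OF cong_inf[OF cong_refl[of z] p] q] by simp
  have r: "(?r, w) \<in> \<theta>"
    using cong_sup[OF cong_refl[of w] cong_neg[OF q]] by (simp add: neg_top)
  have "?l \<sqinter> ?r = ?l"
    by (rule inf_absorb1[OF inf_imp_imp_neg_le])
  then have "(?l, z \<sqinter> w) \<in> \<theta>"
    using cong_inf[OF l r] by simp
  then show ?thesis
    by (rule cong_trans[OF cong_sym[OF l]])
qed

lemma cong_if_s_top:
  assumes "(s z w, \<top>) \<in> \<theta>"
  shows "(z, w) \<in> \<theta>"
proof -
  have "(z \<rightarrow> w, \<top>) \<in> \<theta>" "(w \<rightarrow> z, \<top>) \<in> \<theta>"
    "(\<sim> z \<rightarrow> \<sim> w, \<top>) \<in> \<theta>" "(\<sim> w \<rightarrow> \<sim> z, \<top>) \<in> \<theta>"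
    by (rule cong_top_mono[OF assms], simp add: s_def le_infI1)+
  then have "(z, z \<sqinter> w) \<in> \<theta>" and "(w, w \<sqinter> z) \<in> \<theta>"
    by (simp_all only: cong_inf_if_imps_top)
  then show ?thesis
    by (metis cong_sym cong_trans inf_commute)
qed

end

theorem proposition4p11:
  fixes x y z w :: "'a::subresiduated_nelson_algebra"
  shows "(z, w) \<in> cong_gen x y \<longleftrightarrow> (s x y \<rightarrow> s z w) = \<top>"
proof
  assume "(z, w) \<in> cong_gen x y"
  moreover have "(x, y) \<in> cong_under (s x y)"
    by (simp add: cong_under_def imp_refl)
  with congruence_cong_under[OF s_open] have "cong_gen x y \<subseteq> cong_under (s x y)"
    by (rule cong_gen_least)
  ultimately show "(s x y \<rightarrow> s z w) = \<top>"
    by (auto simp: cong_under_def)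
next
  assume eq: "(s x y \<rightarrow> s z w) = \<top>"
  note cong = congruence_cong_gen[of x y]
  have "(s x y \<rightarrow> s z w, \<top> \<rightarrow> s z w) \<in> cong_gen x y"
    by (intro cong_imp[OF cong] cong_s_top[OF cong] cong_refl[OF cong] pair_in_cong_gen)
  then have "(\<top> \<rightarrow> s z w, \<top>) \<in> cong_gen x y"
    using eq cong_sym[OF cong] by simp
  then have "(s z w, \<top>) \<in> cong_gen x y"
    by (rule cong_top_mono[OF cong _ top_imp_le])
  then show "(z, w) \<in> cong_gen x y"
    by (rule cong_if_s_top[OF cong])
qed

end
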